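(* Every regular model set in an amenable locally compact group $G$ is right-uniformly mean almost periodic.
   Context: A cut-and-project scheme $(G,H,\mathcal L)$ consists of unimodular locally compact groups $G,H$ and a uniform lattice $\mathcal L$ (countable discrete cocompact subgroup) in $G\times H$ with $\pi^G|_{\mathcal L}$ injective and $\pi^H(\mathcal L)$ dense in $H$. For relatively compact $W\subseteq H$, $\Lambda_W=\pi^G(\mathcal L\cap(G\times W))$; it is a regular model set if moreover $W$ has nonempty interior and $m_H(\partial W)=0$, where $\partial W=\overline W\cap\overline{H\setminus W}$ and $m_H$ is a Haar measure on $H$. $G$ is amenable if it admits a left-invariant mean on $L^\infty(G)$. A set $T\subseteq G$ is right-relatively dense if $KT=G$ for some compact $K$, and left-relatively dense if $TK=G$ for some compact $K$. For a set $\Lambda\subseteq G$ identify $\Lambda$ with the counting measure $\delta_\Lambda(A)=\mathrm{card}(\Lambda\cap A)$; with $m$ a Haar measure on $G$, $\mathcal K$ the nonempty compact subsets of $G$ and $\mathcal K_p$ those of positive measure, the upper Leptin density is $\mathrm{L}^+_\Lambda=\inf_{K\in\mathcal K}\sup_{A\in\mathcal K_p}\delta_\Lambda(A)/m(KA)$. A model set $\Lambda$ in $G$ is right-uniformly mean almost periodic if for every $\varepsilon>0$ there is a set $T\subseteq G$ that is both left- and right-relatively dense such that $\mathrm{L}^+_{\Lambda\,\triangle\,(\Lambda t)}\le\varepsilon$ for every $t\in T$ ($\triangle$ = symmetric difference). *)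

theory Defs
  imports "HOL-Analysis.Analysis" "HOL-Library.Product_Plus"
begin

text \<open>Groups are written additively (Isabelle's class group_add is NOT commutative),
  so the group product g h of the paper is g + h here.\<close>

definition locally_compact_group :: "'g::{topological_group_add,t2_space} itself \<Rightarrow> bool" where
  "locally_compact_group _ \<longleftrightarrow> locally_compact_space (euclidean :: 'g topology)"

definition left_haar_measure :: "'g::{topological_group_add,t2_space} measure \<Rightarrow> bool" where
  "left_haar_measure m \<longleftrightarrow>
     sets m = sets borel \<and> space m = UNIV \<and>
     (\<forall>g A. A \<in> sets borel \<longrightarrow> emeasure m ((\<lambda>x. g + x) ` A) = emeasure m A) \<and>
     (\<forall>K. compact K \<longrightarrow> emeasure m K < \<infinity>) \<and>
     (\<forall>U. open U \<and> U \<noteq> {} \<longrightarrow> emeasure m U > 0) \<and>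
     (\<forall>A \<in> sets borel. emeasure m A = (INF U \<in> {U. open U \<and> A \<subseteq> U}. emeasure m U)) \<and>
     (\<forall>U. open U \<longrightarrow> emeasure m U = (SUP K \<in> {K. compact K \<and> K \<subseteq> U}. emeasure m K))"

text \<open>Unimodular: a left Haar measure which is also right-invariant (this holds for one
  left Haar measure iff it holds for all, by uniqueness).\<close>
definition right_invariant :: "'g::{topological_group_add,t2_space} measure \<Rightarrow> bool" where
  "right_invariant m \<longleftrightarrow>
     (\<forall>g A. A \<in> sets borel \<longrightarrow> emeasure m ((\<lambda>x. x + g) ` A) = emeasure m A)"

definition Linfty :: "'g::{topological_group_add,t2_space} measure \<Rightarrow> ('g \<Rightarrow> real) set" where
  "Linfty m = {f. f \<in> borel_measurable m \<and> (\<exists>C. AE x in m. \<bar>f x\<bar> \<le> C)}"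

definition left_invariant_mean ::
    "'g::{topological_group_add,t2_space} measure \<Rightarrow> (('g \<Rightarrow> real) \<Rightarrow> real) \<Rightarrow> bool" where
  "left_invariant_mean m M \<longleftrightarrow>
     (\<forall>f\<in>Linfty m. \<forall>h\<in>Linfty m. \<forall>a b::real. M (\<lambda>x. a * f x + b * h x) = a * M f + b * M h) \<and>
     (\<forall>f\<in>Linfty m. \<forall>h\<in>Linfty m. (AE x in m. f x = h x) \<longrightarrow> M f = M h) \<and>
     (\<forall>f\<in>Linfty m. (AE x in m. 0 \<le> f x) \<longrightarrow> 0 \<le> M f) \<and>
     M (\<lambda>_. 1) = 1 \<and>
     (\<forall>f\<in>Linfty m. \<forall>g. M (\<lambda>x. f (- g + x)) = M f)"

definition amenable :: "'g::{topological_group_add,t2_space} measure \<Rightarrow> bool" where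
  "amenable m \<longleftrightarrow> (\<exists>M. left_invariant_mean m M)"

definition uniform_lattice :: "('a::{group_add,topological_space}) set \<Rightarrow> bool" where
  "uniform_lattice L \<longleftrightarrow>
     0 \<in> L \<and> (\<forall>x\<in>L. \<forall>y\<in>L. x + y \<in> L) \<and> (\<forall>x\<in>L. - x \<in> L) \<and>
     countable L \<and>
     (\<forall>x\<in>L. \<exists>U. open U \<and> U \<inter> L = {x}) \<and>
     (\<exists>K. compact K \<and> {k + l | k l. k \<in> K \<and> l \<in> L} = UNIV)"

definition cut_and_project_scheme ::
    "'g::{topological_group_add,t2_space} measure \<Rightarrow> 'h::{topological_group_add,t2_space} measure
     \<Rightarrow> ('g \<times> 'h) set \<Rightarrow> bool" where
  "cut_and_project_scheme mG mH L \<longleftrightarrow>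
     locally_compact_group TYPE('g) \<and> locally_compact_group TYPE('h) \<and>
     left_haar_measure mG \<and> right_invariant mG \<and>
     left_haar_measure mH \<and> right_invariant mH \<and>
     uniform_lattice L \<and> inj_on fst L \<and> closure (snd ` L) = UNIV"

definition model_set :: "('g \<times> 'h) set \<Rightarrow> 'h set \<Rightarrow> 'g set" where
  "model_set L W = fst ` (L \<inter> (UNIV \<times> W))"

definition regular_window :: "'h::{topological_group_add,t2_space} measure \<Rightarrow> 'h set \<Rightarrow> bool" where
  "regular_window mH W \<longleftrightarrow> compact (closure W) \<and> interior W \<noteq> {} \<and>
     emeasure mH (closure W \<inter> closure (UNIV - W)) = 0"

definition delta :: "'g set \<Rightarrow> 'g set \<Rightarrow> ennreal" where
  "delta \<Lambda> A = emeasure (count_space UNIV) (\<Lambda> \<inter> A)"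

definition setprod :: "'g::plus set \<Rightarrow> 'g set \<Rightarrow> 'g set" where
  "setprod K A = {k + a | k a. k \<in> K \<and> a \<in> A}"

definition upper_leptin_density :: "'g::{topological_group_add,t2_space} measure \<Rightarrow> 'g set \<Rightarrow> ennreal" where
  "upper_leptin_density m \<Lambda> =
     (INF K \<in> {K. compact K \<and> K \<noteq> {}}.
        SUP A \<in> {A. compact A \<and> A \<noteq> {} \<and> emeasure m A > 0}.
          delta \<Lambda> A / emeasure m (setprod K A))"

definition right_rel_dense :: "'g::{topological_group_add,t2_space} set \<Rightarrow> bool" where
  "right_rel_dense T \<longleftrightarrow> (\<exists>K. compact K \<and> setprod K T = UNIV)"

definition left_rel_dense :: "'g::{topological_group_add,t2_space} set \<Rightarrow> bool" where
  "left_rel_dense T \<longleftrightarrow> (\<exists>K. compact K \<and> setprod T K = UNIV)"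

definition right_uniformly_mean_almost_periodic ::
    "'g::{topological_group_add,t2_space} measure \<Rightarrow> 'g set \<Rightarrow> bool" where
  "right_uniformly_mean_almost_periodic m \<Lambda> \<longleftrightarrow>
     (\<forall>\<epsilon>::real. \<epsilon> > 0 \<longrightarrow>
        (\<exists>T. left_rel_dense T \<and> right_rel_dense T \<and>
           (\<forall>t\<in>T. upper_leptin_density m
                     ((\<Lambda> - (\<lambda>x. x + t) ` \<Lambda>) \<union> ((\<lambda>x. x + t) ` \<Lambda> - \<Lambda>)) \<le> ennreal \<epsilon>)))"

end

theory Submission
  imports Defs
begin

text \<open>For \<open>t = \<pi>\<^sup>G(l)\<close> with \<open>l \<in> L\<close>, the symmetric difference of \<open>\<Lambda>\<^sub>W\<close> and \<open>\<Lambda>\<^sub>W + t\<close> lies in the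
  model set whose window is the symmetric difference of \<open>W\<close> and \<open>W + t\<^sup>*\<close>. If \<open>t\<^sup>*\<close> lies in a small
  neighbourhood \<open>V\<close> of \<open>0\<close>, this window lies close to the null set \<open>\<partial>W\<close>, hence well inside an open set
  of small Haar measure. The Leptin density of a model set with such a window is bounded by a
  constant times that measure: since \<open>L\<^sup>*\<close> is dense in \<open>H\<close>, finitely many weighted points of \<open>L\<^sup>*\<close>
  approximate Haar measure on a compact set, and translating by the corresponding points of \<open>L\<close>
  averages the window out. The set \<open>T\<close> of almost periods is the model set with window \<open>V\<close>.\<close>

section \<open>Product sets, translates and neighbourhoods of zero in topological groups\<close>

lemma setprodI: "k \<in> K \<Longrightarrow> a \<in> A \<Longrightarrow> k + a \<in> setprod K A"
  unfolding setprod_def by blast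

lemma setprod_assoc:
  fixes A B C :: "'a::semigroup_add set"
  shows "setprod (setprod A B) C = setprod A (setprod B C)"
  unfolding setprod_def by (auto simp: add.assoc) (metis add.assoc)+

lemma compact_setprod:
  fixes A B :: "'a::topological_monoid_add set"
  assumes "compact A" "compact B"
  shows "compact (setprod A B)"
proof -
  have "compact ((\<lambda>p. fst p + snd p) ` (A \<times> B))"
    by (intro compact_continuous_image compact_Times assms continuous_intros)
  also have "(\<lambda>p. fst p + snd p) ` (A \<times> B) = setprod A B"
    by (force simp: setprod_def)
  finally show ?thesis .
qed

lemma compact_uminus_image:
  fixes A :: "'a::topological_group_add set"
  assumes "compact A"
  shows "compact (uminus ` A)"
  by (intro compact_continuous_image assms continuous_intros)

lemma open_right_translate:
  fixes V :: "'a::topological_group_add set"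
  assumes "open V"
  shows "open ((\<lambda>x. x + z) ` V)"
proof -
  have "open ((\<lambda>y. y - z) -` V)"
    by (intro open_vimage assms continuous_intros)
  also have "(\<lambda>y. y - z) -` V = (\<lambda>x. x + z) ` V"
    by (force simp: image_iff)
  finally show ?thesis .
qed

lemma open_left_translate:
  fixes V :: "'a::topological_group_add set"
  assumes "open V"
  shows "open ((\<lambda>x. z + x) ` V)"
proof -
  have "open ((\<lambda>y. - z + y) -` V)"
    by (intro open_vimage assms continuous_intros)
  also have "(\<lambda>y. - z + y) -` V = (\<lambda>x. z + x) ` V"
  proof (intro equalityI subsetI)
    fix y assume "y \<in> (\<lambda>y. - z + y) -` V"
    then have "z + (- z + y) \<in> (\<lambda>x. z + x) ` V" by blast
    then show "y \<in> (\<lambda>x. z + x) ` V" by simp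
  qed auto
  finally show ?thesis .
qed

lemma open_uminus_image:
  fixes V :: "'a::topological_group_add set"
  assumes "open V"
  shows "open (uminus ` V)"
proof -
  have "open (uminus -` V)"
    by (intro open_vimage assms continuous_intros)
  also have "uminus -` V = uminus ` V"
    by (force simp: image_iff)
  finally show ?thesis .
qed

text \<open>The preimage of \<open>U\<close> under the joint map is open and contains the slice over
  0; compactness of \<open>C\<close> thickens that slice to a tube. This supplies one neighbourhood
  of 0 that serves all points of a compact set at once.\<close>

lemma tube_at_zero:
  fixes f :: "'a::{topological_space,zero} \<Rightarrow> 'b::topological_space \<Rightarrow> 'c::topological_space"
  assumes "compact C" "open U" "continuous_on UNIV (\<lambda>p. f (fst p) (snd p))"
    and "\<And>c. c \<in> C \<Longrightarrow> f 0 c \<in> U"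
  obtains V where "open V" "0 \<in> V" "\<And>v c. v \<in> V \<Longrightarrow> c \<in> C \<Longrightarrow> f v c \<in> U"
proof -
  have "open ((\<lambda>p. f (fst p) (snd p)) -` U)"
    by (rule open_vimage[OF assms(2,3)])
  moreover have "{0} \<times> C \<subseteq> (\<lambda>p. f (fst p) (snd p)) -` U"
    using assms(4) by auto
  ultimately have "\<exists>V. 0 \<in> V \<and> open V \<and> V \<times> C \<subseteq> (\<lambda>p. f (fst p) (snd p)) -` U"
    by (rule Elementary_Topology.tube_lemma[OF assms(1)])
  then obtain V where "0 \<in> V" "open V" "V \<times> C \<subseteq> (\<lambda>p. f (fst p) (snd p)) -` U"
    by blast
  then show thesis by (intro that[of V]) auto
qed

text \<open>Expressions \<open>- x + y\<close> arise from two points in one left translate of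
  \<open>V\<close>, and from two right translates of \<open>V\<close> that meet. Both separation
  arguments below confine them to \<open>U\<close>.\<close>

lemma zero_nbhd_diff:
  fixes U :: "'a::topological_group_add set"
  assumes "open U" "0 \<in> U"
  obtains V where "open V" "0 \<in> V" "\<And>x y. x \<in> V \<Longrightarrow> y \<in> V \<Longrightarrow> - x + y \<in> U"
proof -
  have "open ((\<lambda>p. - fst p + snd p) -` U)"
    by (intro open_vimage assms continuous_intros)
  moreover have "(0, 0) \<in> (\<lambda>p. - fst p + snd p) -` U"
    using assms by auto
  ultimately obtain A B where "open A" "open B" "(0, 0) \<in> A \<times> B"
      "A \<times> B \<subseteq> (\<lambda>p. - fst p + snd p) -` U"
    by (rule open_prod_elim)
  then show thesis by (intro that[of "A \<inter> B"]) auto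
qed

lemma zero_nbhd_compact:
  assumes "locally_compact_group TYPE('g::{topological_group_add,t2_space})"
  obtains U K where "open U" "compact K" "(0::'g) \<in> U" "U \<subseteq> K"
proof -
  have "\<exists>U K. open U \<and> compact K \<and> (0::'g) \<in> U \<and> U \<subseteq> K"
    using assms unfolding locally_compact_group_def locally_compact_space_def by simp
  then show thesis using that by blast
qed

section \<open>Uniform lattices: finiteness on compact sets and packing\<close>

lemma uniform_latticeD:
  assumes "uniform_lattice L"
  shows "0 \<in> L" "\<And>x y. x \<in> L \<Longrightarrow> y \<in> L \<Longrightarrow> x + y \<in> L" "\<And>x. x \<in> L \<Longrightarrow> - x \<in> L"
    "\<And>x y. x \<in> L \<Longrightarrow> y \<in> L \<Longrightarrow> x - y \<in> L"
    "\<exists>U. open U \<and> U \<inter> L = {0}"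
    "\<exists>K. compact K \<and> {k + l | k l. k \<in> K \<and> l \<in> L} = UNIV"
  using assms unfolding uniform_lattice_def diff_conv_add_uminus
  by (simp_all del: add_uminus_conv_diff)

text \<open>Two lattice points \<open>a\<close>, \<open>b\<close> in one translate
  \<open>p + V1 \<times> V2\<close> have \<open>- a + b\<close> in \<open>U \<inter> L\<close>, so
  they agree. Finitely many such translates cover the compact product, and each contributes at most
  one point.\<close>

lemma finite_lattice_inter_compact:
  fixes L :: "('g::topological_group_add \<times> 'h::topological_group_add) set"
  assumes L: "uniform_lattice L" and "compact A" "compact B"
  shows "finite (L \<inter> A \<times> B)"
proof -
  obtain U where U: "open U" "U \<inter> L = {0}"
    using uniform_latticeD(5)[OF L] by blast
  then have "(0, 0) \<in> U" by (auto simp: zero_prod_def)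
  with U(1) obtain U1 U2 where U12: "open U1" "open U2" "(0, 0) \<in> U1 \<times> U2" "U1 \<times> U2 \<subseteq> U"
    by (rule open_prod_elim)
  obtain V1 where V1: "open V1" "0 \<in> V1" "\<And>x y. x \<in> V1 \<Longrightarrow> y \<in> V1 \<Longrightarrow> - x + y \<in> U1"
    using zero_nbhd_diff[of U1] U12 by auto
  obtain V2 where V2: "open V2" "0 \<in> V2" "\<And>x y. x \<in> V2 \<Longrightarrow> y \<in> V2 \<Longrightarrow> - x + y \<in> U2"
    using zero_nbhd_diff[of U2] U12 by auto
  define N where "N p = (\<lambda>x. fst p + x) ` V1 \<times> (\<lambda>x. snd p + x) ` V2" for p :: "'g \<times> 'h"
  have single: "a = b" if "a \<in> L" "b \<in> L" "a \<in> N p" "b \<in> N p" for a b p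
  proof -
    obtain x1 x2 y1 y2 where *: "x1 \<in> V1" "x2 \<in> V2" "y1 \<in> V1" "y2 \<in> V2"
       "a = p + (x1, x2)" "b = p + (y1, y2)"
      using \<open>a \<in> N p\<close> \<open>b \<in> N p\<close> unfolding N_def by (cases p) auto
    have "- a + b = (- x1 + y1, - x2 + y2)"
      unfolding * by (cases p) (simp add: minus_add add.assoc del: add_uminus_conv_diff)
    then have "- a + b \<in> U" using * V1(3) V2(3) U12(4) by auto
    moreover have "- a + b \<in> L"
      using that(1,2) by (intro uniform_latticeD[OF L])
    ultimately have "- a + b = 0" using U(2) by auto
    then show "a = b" by (metis add.right_neutral add_minus_cancel)
  qed
  have fin: "finite (L \<inter> N p)" for p
  proof (cases "L \<inter> N p = {}")
    case False
    then obtain a where "a \<in> L \<inter> N p" by blast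
    then have "L \<inter> N p \<subseteq> {a}" using single by blast
    then show ?thesis by (rule finite_subset) simp
  qed simp
  have "compact (A \<times> B)" by (intro compact_Times assms)
  moreover have "open (N p)" for p
    unfolding N_def by (intro open_Times open_left_translate V1 V2)
  moreover have "A \<times> B \<subseteq> (\<Union>p\<in>A \<times> B. N p)"
    unfolding N_def using V1(2) V2(2) by (force simp: image_iff)
  ultimately obtain F where F: "finite F" "A \<times> B \<subseteq> (\<Union>p\<in>F. N p)"
    by (rule compactE_image)
  then have "L \<inter> A \<times> B \<subseteq> (\<Union>p\<in>F. L \<inter> N p)" by blast
  then show ?thesis by (rule finite_subset) (intro finite_UN_I F fin)
qed

text \<open>Points of a model set are uniformly separated, so disjoint right translates of one small
  open set can be packed around them; this uses right invariance of the Haar measure.\<close>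

lemma lattice_packing_bound:
  fixes mG :: "'g::{topological_group_add,t2_space} measure"
    and mH :: "'h::{topological_group_add,t2_space} measure"
  assumes cps: "cut_and_project_scheme mG mH L" and "compact E"
  obtains P K where "open P" "0 \<in> P" "compact K" "P \<subseteq> K"
    "\<And>B. compact B \<Longrightarrow> of_nat (card (L \<inter> B \<times> E)) * emeasure mG P \<le> emeasure mG (setprod K B)"
proof -
  note c = cps[unfolded cut_and_project_scheme_def]
  have L: "uniform_lattice L" and inj: "inj_on fst L" using c by auto
  have sets: "sets mG = sets borel" using c unfolding left_haar_measure_def by auto
  obtain U K where U: "open U" "compact K" "(0::'g) \<in> U" "U \<subseteq> K"
    using zero_nbhd_compact c by blast
  \<comment> \<open>If the translates of \<open>P\<close> by \<open>fst a\<close> and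
    \<open>fst b\<close> meet, where \<open>P \<subseteq> K\<close> and \<open>snd a\<close>,
    \<open>snd b\<close> are in \<open>E\<close>, then \<open>a - b\<close> lies in
    \<open>KK \<times> EE\<close>. Only finitely many lattice points do, independently of
    \<open>B\<close>.\<close>
  define EE where "EE = setprod E (uminus ` E)"
  define KK where "KK = setprod (uminus ` K) K"
  have "compact EE" "compact KK"
    unfolding EE_def KK_def by (intro compact_setprod compact_uminus_image assms U)+
  then have fin: "finite (L \<inter> KK \<times> EE)" by (intro finite_lattice_inter_compact L)
  \<comment> \<open>These are the differences of first coordinates that could make distinct
    translates overlap. Injectivity of \<open>fst\<close> on \<open>L\<close> keeps 0 out of this
    finite set, so \<open>P0\<close> can be chosen to avoid it.\<close>
  define S where "S = fst ` (L \<inter> KK \<times> EE - {0})"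
  have "finite S" unfolding S_def using fin by auto
  moreover have "0 \<notin> S"
  proof
    assume "0 \<in> S"
    then obtain l where l: "l \<in> L" "l \<noteq> 0" "0 = fst l" unfolding S_def by blast
    then show False using inj_onD[OF inj, of l 0] uniform_latticeD(1)[OF L] by simp
  qed
  ultimately have "open (- S)" "0 \<in> - S"
    by (auto intro: finite_imp_closed)
  then obtain P0 where P0: "open P0" "0 \<in> P0" "\<And>x y. x \<in> P0 \<Longrightarrow> y \<in> P0 \<Longrightarrow> - x + y \<in> - S"
    using zero_nbhd_diff[of "- S"] by blast
  define P where "P = P0 \<inter> U"
  have P: "open P" "0 \<in> P" "P \<subseteq> K" unfolding P_def using P0 U by auto
  have "of_nat (card (L \<inter> B \<times> E)) * emeasure mG P \<le> emeasure mG (setprod K B)"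
    if "compact B" for B
  proof -
    define Z where "Z = L \<inter> B \<times> E"
    have "finite Z" unfolding Z_def by (intro finite_lattice_inter_compact L that assms)
    define R where "R z = (\<lambda>x. x + fst z) ` P" for z :: "'g \<times> 'h"
    have R_sets: "R z \<in> sets mG" for z
      unfolding sets R_def by (intro borel_open open_right_translate P)
    have "disjoint_family_on R Z"
      unfolding disjoint_family_on_def
    proof (intro ballI impI, rule ccontr)
      fix a b assume ab: "a \<in> Z" "b \<in> Z" "a \<noteq> b" "R a \<inter> R b \<noteq> {}"
      then obtain x y where xy: "x \<in> P" "y \<in> P" "x + fst a = y + fst b"
        unfolding R_def by auto
      then have "- x + (x + fst a) = - x + (y + fst b)" by simp
      then have eq: "fst a - fst b = - x + y"
        by (simp add: diff_eq_eq add.assoc flip: add.assoc[of "- x" x])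
      have "a - b \<in> L"
        using ab unfolding Z_def by (intro uniform_latticeD[OF L]) auto
      moreover have "fst (a - b) \<in> KK"
        using xy P eq unfolding KK_def setprod_def by auto
      moreover have "snd (a - b) \<in> EE"
        using ab unfolding EE_def Z_def diff_conv_add_uminus snd_add snd_uminus
        by (intro setprodI imageI) auto
      ultimately have "fst (a - b) \<in> S"
        unfolding S_def using ab(3) by (auto simp: mem_Times_iff simp del: fst_diff intro!: imageI)
      then show False using P0(3)[of x y] xy eq unfolding P_def by auto
    qed
    then have "(\<Sum>z\<in>Z. emeasure mG (R z)) = emeasure mG (\<Union>z\<in>Z. R z)"
      by (intro sum_emeasure) (use R_sets \<open>finite Z\<close> in auto)
    moreover have "emeasure mG (R z) = emeasure mG P" for z
      using c P(1) unfolding R_def right_invariant_def by (auto intro: borel_open)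
    moreover have "emeasure mG (\<Union>z\<in>Z. R z) \<le> emeasure mG (setprod K B)"
    proof (rule emeasure_mono)
      show "(\<Union>z\<in>Z. R z) \<subseteq> setprod K B"
        using P(3) unfolding R_def Z_def by (auto intro!: setprodI)
      show "setprod K B \<in> sets mG"
        unfolding sets by (intro borel_closed compact_imp_closed compact_setprod U that)
    qed
    ultimately show ?thesis by (simp add: Z_def)
  qed
  then show thesis using that[of P K] P U by blast
qed

section \<open>Weighted covers and double counting\<close>

text \<open>The weights are the measures of disjoint pieces \<open>Q i \<subseteq> B i\<close> with
  the same union. Taking the measures of the \<open>B i\<close> themselves would count overlaps
  repeatedly.\<close>

lemma subadditive_weights:
  fixes B :: "'i \<Rightarrow> 'a set"
  assumes "finite F" "\<And>i. i \<in> F \<Longrightarrow> B i \<in> sets m"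
  obtains w :: "'i \<Rightarrow> ennreal" where
    "sum w F = emeasure m (\<Union>i\<in>F. B i)"
    "\<And>S. S \<subseteq> F \<Longrightarrow> sum w S \<le> emeasure m (\<Union>i\<in>S. B i)"
proof -
  have "\<exists>Q. disjoint_family_on Q F \<and> (\<forall>i\<in>F. Q i \<in> sets m \<and> Q i \<subseteq> B i)
      \<and> (\<Union>i\<in>F. Q i) = (\<Union>i\<in>F. B i)"
    using assms
  proof (induction F)
    case empty
    then show ?case by (auto simp: disjoint_family_on_def)
  next
    case (insert i F)
    then obtain Q where Q: "disjoint_family_on Q F" "\<forall>i\<in>F. Q i \<in> sets m \<and> Q i \<subseteq> B i"
      "(\<Union>i\<in>F. Q i) = (\<Union>i\<in>F. B i)" by auto
    \<comment> \<open>The new index receives only what the earlier sets leave uncovered.\<close>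
    define Q' where "Q' = Q(i := B i - (\<Union>j\<in>F. B j))"
    have Q': "Q' j = Q j" if "j \<in> F" for j using insert.hyps that unfolding Q'_def by auto
    have i: "Q' i = B i - (\<Union>j\<in>F. Q j)" unfolding Q'_def Q by simp
    have "(\<Union>j\<in>F. B j) \<in> sets m" using insert by (intro sets.finite_UN) auto
    then have "Q' i \<in> sets m" using insert unfolding Q'_def by auto
    moreover have "disjoint_family_on Q' (insert i F)"
      using Q(1) Q' i insert.hyps(2) unfolding disjoint_family_on_def by (auto; blast)
    moreover have "(\<Union>j\<in>insert i F. Q' j) = (\<Union>j\<in>insert i F. B j)"
      using Q' i Q(3) by auto
    moreover have "Q' i \<subseteq> B i" using i by auto
    ultimately show ?case using Q(2) Q' by (intro exI[of _ Q']) auto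
  qed
  then obtain Q where Q: "disjoint_family_on Q F" "\<And>i. i \<in> F \<Longrightarrow> Q i \<in> sets m"
    "\<And>i. i \<in> F \<Longrightarrow> Q i \<subseteq> B i" "(\<Union>i\<in>F. Q i) = (\<Union>i\<in>F. B i)" by blast
  have *: "(\<Sum>i\<in>S. emeasure m (Q i)) = emeasure m (\<Union>i\<in>S. Q i)" if "S \<subseteq> F" for S
    using that Q assms(1)
    by (intro sum_emeasure disjoint_family_on_mono[OF that Q(1)]) (auto intro: finite_subset)
  show thesis
  proof (rule that[of "\<lambda>i. emeasure m (Q i)"])
    show "(\<Sum>i\<in>F. emeasure m (Q i)) = emeasure m (\<Union>i\<in>F. B i)"
      using *[of F] Q(4) by simp
    show "(\<Sum>i\<in>S. emeasure m (Q i)) \<le> emeasure m (\<Union>i\<in>S. B i)" if "S \<subseteq> F" for S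
      unfolding *[OF that]
    proof (rule emeasure_mono)
      show "(\<Union>i\<in>S. Q i) \<subseteq> (\<Union>i\<in>S. B i)" using Q(3) that by blast
      show "(\<Union>i\<in>S. B i) \<in> sets m"
        using that assms by (intro sets.finite_UN) (auto intro: finite_subset)
    qed
  qed
qed

text \<open>Pairs \<open>(s, z)\<close> with \<open>s + z \<in> X\<close>, weighted by
  \<open>w s\<close>, are summed in both orders. For fixed \<open>s\<close> there are exactly
  \<open>card X\<close> of them, through \<open>l \<mapsto> - s + l\<close>; for fixed
  \<open>z\<close> their weight is at most \<open>M\<close>.\<close>

lemma translate_double_counting:
  fixes X Z F :: "'a::group_add set" and w :: "'a \<Rightarrow> ennreal"
  assumes fin: "finite F" "finite Z"
    and Z: "\<And>s l. s \<in> F \<Longrightarrow> l \<in> X \<Longrightarrow> - s + l \<in> Z"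
    and M: "\<And>z. z \<in> Z \<Longrightarrow> sum w {s\<in>F. s + z \<in> X} \<le> M"
  shows "of_nat (card X) * sum w F \<le> of_nat (card Z) * M"
proof -
  have card: "card X = card {z\<in>Z. s + z \<in> X}" if "s \<in> F" for s
  proof -
    have "{z\<in>Z. s + z \<in> X} = (\<lambda>l. - s + l) ` X"
      using Z[OF that] by (force simp: image_iff simp flip: add.assoc)
    then show ?thesis by (simp add: card_image)
  qed
  have "of_nat (card X) * sum w F = (\<Sum>s\<in>F. of_nat (card {z\<in>Z. s + z \<in> X}) * w s)"
    unfolding sum_distrib_left by (intro sum.cong refl) (simp add: card)
  also have "\<dots> = (\<Sum>s\<in>F. \<Sum>z\<in>Z. if s + z \<in> X then w s else 0)"
    by (intro sum.cong refl) (simp add: sum.If_cases fin Int_def)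
  also have "\<dots> = (\<Sum>z\<in>Z. \<Sum>s\<in>F. if s + z \<in> X then w s else 0)"
    by (rule sum.swap)
  also have "\<dots> = (\<Sum>z\<in>Z. sum w {s\<in>F. s + z \<in> X})"
    by (rule sum.cong) (simp_all add: sum.If_cases fin Int_def)
  also have "\<dots> \<le> (\<Sum>z\<in>Z. M)" by (intro sum_mono M)
  finally show ?thesis by simp
qed

section \<open>Leptin density of model sets\<close>

lemma dense_projectionE:
  assumes "closure (snd ` L) = UNIV" "open S" "S \<noteq> {}"
  obtains l where "l \<in> L" "snd l \<in> S"
  using assms open_Int_closure_eq_empty[of S "snd ` L"] by auto

lemma delta_model_set_le:
  assumes "finite (L \<inter> A \<times> C)"
  shows "delta (model_set L C) A \<le> of_nat (card (L \<inter> A \<times> C))"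
proof -
  have eq: "model_set L C \<inter> A = fst ` (L \<inter> A \<times> C)"
    unfolding model_set_def by force
  then have "delta (model_set L C) A = of_nat (card (fst ` (L \<inter> A \<times> C)))"
    unfolding delta_def using assms by (simp add: emeasure_count_space)
  also have "\<dots> \<le> of_nat (card (L \<inter> A \<times> C))"
    using card_image_le[OF assms] by (intro of_nat_mono)
  finally show ?thesis .
qed

lemma upper_leptin_density_mono:
  assumes "A \<subseteq> B"
  shows "upper_leptin_density m A \<le> upper_leptin_density m B"
  unfolding upper_leptin_density_def delta_def
  by (intro INF_mono' SUP_mono' divide_right_mono_ennreal emeasure_mono) (use assms in auto)

text \<open>Turns the product inequality into a bound on the Leptin quotient, with \<open>y\<close>
  the measure of a product set. If \<open>y = 0\<close> then \<open>x = 0\<close>, and the quotient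
  is 0 in \<open>ennreal\<close>.\<close>

lemma ennreal_divide_le_cross:
  fixes x y a b :: ennreal
  assumes "x * a \<le> b * y" "a \<noteq> 0" "a \<noteq> top"
  shows "x / y \<le> inverse a * b"
proof (cases "y = 0")
  case True
  then have "x = 0" using assms by auto
  then show ?thesis by simp
next
  case False
  have "x = x * a / a" using assms by (simp add: mult_divide_eq_ennreal)
  also have "\<dots> \<le> b * y / a" by (intro divide_right_mono_ennreal assms)
  also have "\<dots> = inverse a * b * y" by (simp add: divide_ennreal_def mult_ac)
  finally show ?thesis using False by (intro divide_le_posI_ennreal) (auto simp: zero_less_iff_neq_zero mult_ac)
qed

text \<open>A compact set \<open>N\<close> in \<open>H\<close> is cut into pieces contained in translates \<open>V + s\<^sup>*\<close> with
  \<open>s \<in> L\<close>, and each \<open>s\<close> gets the Haar measure of its piece as weight. A point \<open>z\<close> of the lattice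
  is hit by translates \<open>l \<mapsto> - s + l\<close> of points with second coordinate in \<open>C\<close> only if
  \<open>s\<^sup>* \<in> C - z\<^sup>*\<close>, and the weight of all such \<open>s\<close> is at most the measure of \<open>V + C - z\<^sup>*\<close>.\<close>

lemma upper_leptin_density_model_set_le:
  fixes mG :: "'g::{topological_group_add,t2_space} measure"
    and mH :: "'h::{topological_group_add,t2_space} measure"
  assumes cps: "cut_and_project_scheme mG mH L" and E: "compact E"
  obtains c :: ennreal where "c < top"
    "\<And>C V U. C \<subseteq> E \<Longrightarrow> open V \<Longrightarrow> 0 \<in> V \<Longrightarrow> open U \<Longrightarrow>
       (\<And>v x. v \<in> V \<Longrightarrow> x \<in> C \<Longrightarrow> v + x \<in> U) \<Longrightarrow>
       upper_leptin_density mG (model_set L C) \<le> c * emeasure mH U"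
proof -
  note c = cps[unfolded cut_and_project_scheme_def]
  have L: "uniform_lattice L" and dense: "closure (snd ` L) = UNIV" using c by auto
  have mG: "left_haar_measure mG" and mH: "left_haar_measure mH" "right_invariant mH"
    using c by auto
  have setsG: "sets mG = sets borel" and setsH: "sets mH = sets borel"
    using mG mH unfolding left_haar_measure_def by auto
  obtain U0 N where U0: "open U0" "compact N" "(0::'h) \<in> U0" "U0 \<subseteq> N"
    using zero_nbhd_compact c by blast
  have N0: "0 \<in> N" using U0 by blast
  \<comment> \<open>The lattice points \<open>s\<close> chosen below have \<open>snd s\<close> in
    \<open>NN\<close>, so adding \<open>- snd s\<close> on the left of a point of \<open>E\<close>
    stays in \<open>E'\<close>. Both sets are fixed before \<open>C\<close>, \<open>V\<close> and
    \<open>U\<close>, which keeps the constant independent of these.\<close>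
  define NN where "NN = setprod (uminus ` N) N"
  define E' where "E' = setprod (uminus ` NN) E"
  have "compact E'"
    unfolding E'_def NN_def by (intro compact_setprod compact_uminus_image E U0)
  then obtain P K where P: "open P" "0 \<in> P" "compact K" "P \<subseteq> K" and
    packing: "\<And>B. compact B \<Longrightarrow>
      of_nat (card (L \<inter> B \<times> E')) * emeasure mG P \<le> emeasure mG (setprod K B)"
    using lattice_packing_bound[OF cps] by blast
  \<comment> \<open>The first factor bounds the total weight from below, the second comes from the
    packing bound; the constant of the lemma is \<open>inverse a\<close>.\<close>
  define a where "a = emeasure mH N * emeasure mG P"
  have "emeasure mG P > 0" using mG P unfolding left_haar_measure_def by blast
  moreover have "emeasure mH N > 0"
  proof -
    have "0 < emeasure mH U0" using mH U0 unfolding left_haar_measure_def by blast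
    also have "\<dots> \<le> emeasure mH N"
      by (intro emeasure_mono U0) (simp add: setsH U0 compact_imp_closed)
    finally show ?thesis .
  qed
  ultimately have a0: "a \<noteq> 0" unfolding a_def by auto
  have "emeasure mG P \<le> emeasure mG K"
    by (intro emeasure_mono P) (simp add: setsG P compact_imp_closed)
  also have "\<dots> < top" using mG P unfolding left_haar_measure_def by auto
  finally have "emeasure mG P < top" .
  moreover have "emeasure mH N < top" using mH U0 unfolding left_haar_measure_def by auto
  ultimately have a_top: "a \<noteq> top" unfolding a_def by (auto simp: ennreal_mult_eq_top_iff)
  have "upper_leptin_density mG (model_set L C) \<le> inverse a * emeasure mH U"
    if C: "C \<subseteq> E" and V: "open V" "0 \<in> V" and U: "open U"
      and CU: "\<And>v x. v \<in> V \<Longrightarrow> x \<in> C \<Longrightarrow> v + x \<in> U" for C V U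
  proof -
    \<comment> \<open>Intersecting with \<open>U0 \<subseteq> N\<close> forces
      \<open>snd s \<in> NN\<close> whenever \<open>B s\<close> meets \<open>N\<close>.\<close>
    define V' where "V' = V \<inter> U0"
    have V': "open V'" "0 \<in> V'" unfolding V'_def using V U0 by auto
    define B where "B s = (\<lambda>v. v + snd s) ` V'" for s :: "'g \<times> 'h"
    have B_open: "open (B s)" for s unfolding B_def by (intro open_right_translate V')
    define I where "I = {s\<in>L. snd s \<in> NN}"
    \<comment> \<open>\<open>d \<in> V' + snd s\<close> means that \<open>snd s\<close> lies in
      \<open>- V' + d\<close>, a nonempty open set, which the dense projection of \<open>L\<close>
      meets.\<close>
    have "N \<subseteq> (\<Union>s\<in>I. B s)"
    proof
      fix d assume d: "d \<in> N"
      have "open ((\<lambda>x. x + d) ` uminus ` V')"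
        by (intro open_right_translate open_uminus_image V')
      moreover have "(\<lambda>x. x + d) ` uminus ` V' \<noteq> {}" using V' by auto
      ultimately obtain s where s: "s \<in> L" "snd s \<in> (\<lambda>x. x + d) ` uminus ` V'"
        using dense_projectionE[OF dense] by blast
      then obtain v where v: "v \<in> V'" "snd s = - v + d" by auto
      have "snd s \<in> NN"
        unfolding v NN_def using v(1) U0 d by (intro setprodI imageI) (auto simp: V'_def)
      moreover have "d = v + snd s" using v by (simp flip: add.assoc)
      ultimately show "d \<in> (\<Union>s\<in>I. B s)" using s v unfolding I_def B_def by blast
    qed
    with U0(2) B_open obtain F where F: "F \<subseteq> I" "finite F" "N \<subseteq> (\<Union>s\<in>F. B s)"
      by (metis compactE_image)
    have "F \<noteq> {}" using F N0 by auto
    obtain w where w: "sum w F = emeasure mH (\<Union>s\<in>F. B s)"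
      "\<And>S. S \<subseteq> F \<Longrightarrow> sum w S \<le> emeasure mH (\<Union>s\<in>S. B s)"
      using subadditive_weights[OF F(2), of B mH] B_open setsH by auto
    have wN: "emeasure mH N \<le> sum w F"
      unfolding w by (intro emeasure_mono F) (auto simp: setsH intro!: borel_open B_open)
    define F1 where "F1 = uminus ` fst ` F"
    \<comment> \<open>\<open>setprod F1 A\<close> contains the first coordinates of all
      \<open>- s + l\<close> with \<open>s \<in> F\<close> and \<open>fst l \<in> A\<close>, and
      \<open>setprod K (setprod F1 A)\<close> is \<open>setprod K' A\<close>. The packing bound thus
      yields the Leptin denominator for \<open>K'\<close>, which is chosen before \<open>A\<close>
      as the infimum requires.\<close>
    define K' where "K' = setprod K F1"
    have "compact F1" unfolding F1_def by (intro finite_imp_compact finite_imageI F)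
    have K': "compact K'" "K' \<noteq> {}"
    proof -
      show "compact K'" unfolding K'_def by (intro compact_setprod P \<open>compact F1\<close>)
      obtain f where "f \<in> F1" using \<open>F \<noteq> {}\<close> unfolding F1_def by blast
      then have "0 + f \<in> K'" unfolding K'_def using P by (intro setprodI) auto
      then show "K' \<noteq> {}" by blast
    qed
    have "delta (model_set L C) A / emeasure mG (setprod K' A) \<le> inverse a * emeasure mH U"
      if A: "compact A" for A
    proof -
      define X where "X = L \<inter> A \<times> C"
      define Z where "Z = L \<inter> setprod F1 A \<times> E'"
      have "finite (L \<inter> A \<times> E)" by (intro finite_lattice_inter_compact L A E)
      then have "finite X" by (rule rev_finite_subset) (use C X_def in auto)
      have F1A: "compact (setprod F1 A)" by (intro compact_setprod \<open>compact F1\<close> A)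
      have "finite Z"
        unfolding Z_def by (intro finite_lattice_inter_compact L F1A \<open>compact E'\<close>)
      have count: "of_nat (card X) * sum w F \<le> of_nat (card Z) * emeasure mH U"
      proof (rule translate_double_counting)
        show "finite F" "finite Z" by fact+
        fix s l assume sl: "s \<in> F" "l \<in> X"
        have "- s + l \<in> L" using sl F unfolding I_def X_def by (intro uniform_latticeD[OF L]) auto
        moreover have "fst (- s + l) \<in> setprod F1 A"
          unfolding F1_def fst_add fst_uminus using sl
          by (intro setprodI imageI) (auto simp: X_def)
        moreover have "snd (- s + l) \<in> E'"
          unfolding E'_def snd_add snd_uminus using sl F C
          by (intro setprodI imageI) (auto simp: X_def I_def)
        ultimately show "- s + l \<in> Z" unfolding Z_def by (simp add: mem_Times_iff)
      next
        fix z assume "z \<in> Z"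
        let ?S = "{s\<in>F. s + z \<in> X}"
        have "sum w ?S \<le> emeasure mH (\<Union>s\<in>?S. B s)" by (intro w) auto
        also have "\<dots> \<le> emeasure mH ((\<lambda>x. x + - snd z) ` U)"
        proof (rule emeasure_mono)
          show "(\<lambda>x. x + - snd z) ` U \<in> sets mH"
            unfolding setsH by (intro borel_open open_right_translate U)
          show "(\<Union>s\<in>?S. B s) \<subseteq> (\<lambda>x. x + - snd z) ` U"
          proof
            fix y assume "y \<in> (\<Union>s\<in>?S. B s)"
            then obtain s v where sv: "s + z \<in> X" "v \<in> V'" "y = v + snd s"
              unfolding B_def by auto
            have "v + snd (s + z) \<in> U"
              using sv by (intro CU) (auto simp: V'_def X_def mem_Times_iff)
            moreover have "y = v + snd (s + z) + - snd z"
              using sv by (simp add: add.assoc del: add_uminus_conv_diff)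
            ultimately show "y \<in> (\<lambda>x. x + - snd z) ` U" by blast
          qed
        qed
        also have "\<dots> = emeasure mH U"
          using mH(2) borel_open[OF U] unfolding right_invariant_def by blast
        finally show "sum w ?S \<le> emeasure mH U" .
      qed
      have "of_nat (card X) * a = of_nat (card X) * emeasure mH N * emeasure mG P"
        unfolding a_def by (simp add: mult.assoc)
      also have "\<dots> \<le> of_nat (card X) * sum w F * emeasure mG P"
        by (intro mult_mono wN) auto
      also have "\<dots> \<le> of_nat (card Z) * emeasure mH U * emeasure mG P"
        by (intro mult_right_mono count) auto
      also have "\<dots> = emeasure mH U * (of_nat (card Z) * emeasure mG P)"
        by (simp add: mult_ac)
      also have "\<dots> \<le> emeasure mH U * emeasure mG (setprod K' A)"
        using packing[OF F1A] unfolding K'_def setprod_assoc Z_def by (intro mult_left_mono) auto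
      finally have X: "of_nat (card X) * a \<le> emeasure mH U * emeasure mG (setprod K' A)" .
      have "delta (model_set L C) A \<le> of_nat (card X)"
        using \<open>finite X\<close> unfolding X_def by (rule delta_model_set_le)
      then have "delta (model_set L C) A * a \<le> of_nat (card X) * a"
        by (intro mult_right_mono) auto
      then show ?thesis
        by (intro ennreal_divide_le_cross a0 a_top order_trans[OF _ X])
    qed
    then show ?thesis
      unfolding upper_leptin_density_def using K'
      by (intro INF_lower2[of K'] SUP_least) auto
  qed
  moreover have "inverse a < top" using a0 by (simp add: less_top[symmetric])
  ultimately show thesis using that[of "inverse a"] by blast
qed

section \<open>Relative density of model sets with open window\<close>

text \<open>Write \<open>(g, 0) = k + l\<close> with \<open>k \<in> K\<close>. Then
  \<open>snd l\<close> lies in the compact set \<open>Y\<close>, and one of finitely many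
  \<open>s \<in> L\<close> moves it into \<open>V\<close>. Hence \<open>g\<close> is
  \<open>fst k - fst s\<close>, from a compact set, plus the point \<open>fst (s + l)\<close> of the
  model set.\<close>

lemma right_rel_dense_model_set:
  fixes L :: "('g::{topological_group_add,t2_space} \<times> 'h::{topological_group_add,t2_space}) set"
  assumes L: "uniform_lattice L" and dense: "closure (snd ` L) = UNIV"
    and V: "open V" "V \<noteq> {}"
  shows "right_rel_dense (model_set L V)"
proof -
  obtain K where K: "compact K" "{k + l | k l. k \<in> K \<and> l \<in> L} = UNIV"
    using uniform_latticeD(6)[OF L] by blast
  define Y where "Y = uminus ` snd ` K"
  have "compact Y" unfolding Y_def
    by (intro compact_uminus_image compact_continuous_image K continuous_intros)
  moreover have "open ((\<lambda>x. - snd s + x) ` V)" for s :: "'g \<times> 'h"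
    by (intro open_left_translate V)
  moreover have "Y \<subseteq> (\<Union>s\<in>L. (\<lambda>x. - snd s + x) ` V)"
  proof
    fix y assume "y \<in> Y"
    have "open ((\<lambda>x. x + - y) ` V)" by (intro open_right_translate V)
    then obtain s where s: "s \<in> L" "snd s \<in> (\<lambda>x. x + - y) ` V"
      using dense_projectionE[OF dense] V by blast
    then obtain v where "v \<in> V" "snd s = v + - y" by blast
    then have "y = - snd s + v" by (simp add: minus_diff_eq del: minus_add)
    then show "y \<in> (\<Union>s\<in>L. (\<lambda>x. - snd s + x) ` V)" using s \<open>v \<in> V\<close> by blast
  qed
  ultimately obtain F where F: "F \<subseteq> L" "finite F" "Y \<subseteq> (\<Union>s\<in>F. (\<lambda>x. - snd s + x) ` V)"
    by (rule compactE_image)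
  define KK where "KK = setprod (fst ` K) (uminus ` fst ` F)"
  have "compact KK" unfolding KK_def
    by (intro compact_setprod compact_continuous_image K finite_imp_compact finite_imageI F
        continuous_intros)
  moreover have "g \<in> setprod KK (model_set L V)" for g
  proof -
    have "(g, 0) \<in> {k + l | k l. k \<in> K \<and> l \<in> L}" using K by blast
    then obtain k l where kl: "k \<in> K" "l \<in> L" "(g, 0) = k + l" by blast
    have g: "g = fst k + fst l" using arg_cong[OF kl(3), of fst] by simp
    have "0 = snd k + snd l" using arg_cong[OF kl(3), of snd] by simp
    then have "snd l = - snd k" by (metis minus_unique)
    then have "snd l \<in> Y" unfolding Y_def using kl by blast
    then obtain s v where s: "s \<in> F" "v \<in> V" "snd l = - snd s + v" using F by blast
    have "s + l \<in> L" using s F kl by (intro uniform_latticeD[OF L]) auto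
    moreover have "snd (s + l) = v" using s by (simp flip: add.assoc)
    ultimately have "fst (s + l) \<in> model_set L V"
      unfolding model_set_def using s by (intro imageI) (auto simp: mem_Times_iff)
    moreover have "fst k + - fst s \<in> KK"
      unfolding KK_def using kl s by (intro setprodI imageI)
    ultimately have "(fst k + - fst s) + fst (s + l) \<in> setprod KK (model_set L V)"
      by (intro setprodI)
    moreover have "(fst k + - fst s) + fst (s + l) = g"
      unfolding g by (simp add: add.assoc del: add_uminus_conv_diff)
    ultimately show ?thesis by simp
  qed
  ultimately show ?thesis unfolding right_rel_dense_def by blast
qed

text \<open>Negation preserves \<open>L\<close>, exchanges the windows \<open>V\<close> and
  \<open>- V\<close>, and reverses sums, so the claim is right relative density for
  \<open>- V\<close>.\<close>

lemma left_rel_dense_model_set: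
  fixes L :: "('g::{topological_group_add,t2_space} \<times> 'h::{topological_group_add,t2_space}) set"
  assumes L: "uniform_lattice L" and dense: "closure (snd ` L) = UNIV"
    and V: "open V" "V \<noteq> {}"
  shows "left_rel_dense (model_set L V)"
proof -
  have "right_rel_dense (model_set L (uminus ` V))"
    by (intro right_rel_dense_model_set L dense open_uminus_image) (use V in auto)
  then obtain K where K: "compact K" "setprod K (model_set L (uminus ` V)) = UNIV"
    unfolding right_rel_dense_def by blast
  have "g \<in> setprod (model_set L V) (uminus ` K)" for g
  proof -
    have "- g \<in> setprod K (model_set L (uminus ` V))" using K by blast
    then obtain k l where kl: "k \<in> K" "l \<in> L" "snd l \<in> uminus ` V" "- g = k + fst l"
      unfolding setprod_def model_set_def by auto
    have "- l \<in> L" using kl by (intro uniform_latticeD[OF L])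
    then have "fst (- l) \<in> model_set L V"
      unfolding model_set_def using kl by (intro imageI) (auto simp: mem_Times_iff)
    then have "fst (- l) + - k \<in> setprod (model_set L V) (uminus ` K)"
      using kl by (intro setprodI imageI)
    moreover have "g = fst (- l) + - k"
      using arg_cong[OF kl(4), of uminus] by (simp add: minus_add)
    ultimately show ?thesis by simp
  qed
  then show ?thesis
    unfolding left_rel_dense_def using compact_uminus_image[OF K(1)] by blast
qed

section \<open>Small translates and the boundary of the window\<close>

text \<open>This moves the problem from \<open>G\<close> to \<open>H\<close>. Points are lifted to
  \<open>p \<in> L\<close>; if \<open>snd p\<close> were in the translated window,
  \<open>p - l\<close> would exhibit \<open>fst p\<close> in the translated model set. The other
  half uses \<open>p + l\<close>.\<close>

lemma model_set_sym_diff_translate: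
  fixes L :: "('g::{group_add,topological_space} \<times> 'h::{group_add,topological_space}) set"
  assumes L: "uniform_lattice L" and l: "l \<in> L"
  shows "(model_set L W - (\<lambda>x. x + fst l) ` model_set L W)
       \<union> ((\<lambda>x. x + fst l) ` model_set L W - model_set L W)
     \<subseteq> model_set L ((W - (\<lambda>x. x + snd l) ` W) \<union> ((\<lambda>x. x + snd l) ` W - W))"
proof -
  have mem: "x \<in> model_set L S \<longleftrightarrow> (\<exists>p\<in>L. snd p \<in> S \<and> x = fst p)" for x and S :: "'h set"
    unfolding model_set_def by force
  show ?thesis
  proof (rule subsetI, erule UnE)
    fix x assume x: "x \<in> model_set L W - (\<lambda>x. x + fst l) ` model_set L W"
    then have "x \<in> model_set L W" by blast
    then obtain p where p: "p \<in> L" "snd p \<in> W" "x = fst p" unfolding mem by blast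
    have "snd p \<notin> (\<lambda>x. x + snd l) ` W"
    proof
      assume "snd p \<in> (\<lambda>x. x + snd l) ` W"
      then have "snd (p - l) \<in> W" by auto
      moreover have "p - l \<in> L" using p l by (intro uniform_latticeD[OF L])
      ultimately have "fst (p - l) \<in> model_set L W" unfolding mem by blast
      moreover have "x = fst (p - l) + fst l" using p by simp
      ultimately show False using x by blast
    qed
    then show "x \<in> model_set L ((W - (\<lambda>x. x + snd l) ` W) \<union> ((\<lambda>x. x + snd l) ` W - W))"
      unfolding mem using p by blast
  next
    fix x assume x: "x \<in> (\<lambda>x. x + fst l) ` model_set L W - model_set L W"
    then obtain y where "y \<in> model_set L W" "x = y + fst l" by blast
    then obtain p where p: "p \<in> L" "snd p \<in> W" "x = fst p + fst l" unfolding mem by blast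
    have "p + l \<in> L" using p l by (intro uniform_latticeD[OF L])
    moreover have "x = fst (p + l)" using p by simp
    moreover have "snd (p + l) \<in> (\<lambda>x. x + snd l) ` W" using p by simp
    moreover have "snd (p + l) \<notin> W" using x calculation mem[of x W] by blast
    ultimately show "x \<in> model_set L ((W - (\<lambda>x. x + snd l) ` W) \<union> ((\<lambda>x. x + snd l) ` W - W))"
      unfolding mem by blast
  qed
qed

text \<open>Outer regularity encloses \<open>B\<close> in an open \<open>U\<close> of small measure.
  The intermediate \<open>Q\<close> will contain the windows of the symmetric differences, and
  \<open>V\<close> is the margin around them that the density bound asks for.\<close>

lemma compact_null_inner_outer_nbhd:
  fixes m :: "'h::{topological_group_add,t2_space} measure"
  assumes m: "left_haar_measure m" and B: "compact B" "emeasure m B = 0" and \<delta>: "\<delta> > 0"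
  obtains Q U V where "open Q" "B \<subseteq> Q" "open U" "emeasure m U < \<delta>" "open V" "0 \<in> V"
    "\<And>v x. v \<in> V \<Longrightarrow> x \<in> Q \<Longrightarrow> v + x \<in> U"
proof -
  have "B \<in> sets borel" using B by (simp add: compact_imp_closed)
  then have "(INF U \<in> {U. open U \<and> B \<subseteq> U}. emeasure m U) = 0"
    using m B(2) unfolding left_haar_measure_def by metis
  then obtain U where U: "open U" "B \<subseteq> U" "emeasure m U < \<delta>"
    using \<delta> by (metis (no_types, lifting) INF_less_iff mem_Collect_eq)
  \<comment> \<open>The parameter is a pair, so one tube yields both \<open>V1\<close> for the
    margin and \<open>V2\<close> for the thickening \<open>Q\<close> of \<open>B\<close>.\<close>
  have "continuous_on UNIV (\<lambda>q. fst (fst q) + (snd (fst q) + snd q) :: 'h)"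
    by (intro continuous_intros)
  then obtain P where P: "open P" "0 \<in> P"
    "\<And>p b. p \<in> P \<Longrightarrow> b \<in> B \<Longrightarrow> fst p + (snd p + b) \<in> U"
    using tube_at_zero[OF B(1) U(1), of "\<lambda>p b. fst p + (snd p + b)"] U(2) by auto
  obtain V1 V2 where V12: "open V1" "open V2" "(0, 0) \<in> V1 \<times> V2" "V1 \<times> V2 \<subseteq> P"
    using P(1,2) unfolding zero_prod_def by (rule open_prod_elim)
  define Q where "Q = (\<Union>b\<in>B. (\<lambda>x. x + b) ` V2)"
  show thesis
  proof (rule that[of Q U V1])
    show "open Q" unfolding Q_def by (intro open_UN ballI open_right_translate V12)
    show "B \<subseteq> Q" using V12(3) unfolding Q_def by (force simp: image_iff)
    show "v + x \<in> U" if "v \<in> V1" "x \<in> Q" for v x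
      using that P(3) V12(4) unfolding Q_def by force
  qed (use U V12 in auto)
qed

text \<open>\<open>closure W\<close> lies in the open set \<open>interior W \<union> Q\<close>, so
  small translates of it leave \<open>W\<close> only within \<open>Q\<close>. Its part outside
  \<open>Q\<close> is a compact subset of \<open>interior W\<close>, so small translates keep that
  part in \<open>W\<close>.\<close>

lemma window_sym_diff_translate:
  fixes W :: "'h::{topological_group_add,t2_space} set"
  assumes W: "compact (closure W)" and Q: "open Q" "closure W \<inter> closure (UNIV - W) \<subseteq> Q"
  obtains V where "open V" "0 \<in> V"
    "\<And>v. v \<in> V \<Longrightarrow> (W - (\<lambda>x. x + v) ` W) \<union> ((\<lambda>x. x + v) ` W - W) \<subseteq> Q"
proof -
  have bd: "closure W \<subseteq> interior W \<union> Q"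
    using Q(2) closure_complement[of W] by (auto simp: Compl_eq_Diff_UNIV)
  have "continuous_on UNIV (\<lambda>p. snd p + fst p :: 'h)" by (intro continuous_intros)
  then obtain V1 where V1: "open V1" "0 \<in> V1"
    "\<And>v c. v \<in> V1 \<Longrightarrow> c \<in> closure W \<Longrightarrow> c + v \<in> interior W \<union> Q"
    using tube_at_zero[OF W, of "interior W \<union> Q" "\<lambda>v c. c + v"] bd Q(1) by auto
  have "compact (closure W - Q)" by (rule compact_diff[OF W Q(1)])
  moreover have "continuous_on UNIV (\<lambda>p. snd p - fst p :: 'h)" by (intro continuous_intros)
  ultimately obtain V2 where V2: "open V2" "0 \<in> V2"
    "\<And>v c. v \<in> V2 \<Longrightarrow> c \<in> closure W - Q \<Longrightarrow> c - v \<in> interior W"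
    using tube_at_zero[of "closure W - Q" "interior W" "\<lambda>v c. c - v"] bd by auto
  show thesis
  proof (rule that[of "V1 \<inter> V2"])
    fix v assume v: "v \<in> V1 \<inter> V2"
    show "(W - (\<lambda>x. x + v) ` W) \<union> ((\<lambda>x. x + v) ` W - W) \<subseteq> Q"
    proof (rule subsetI, erule UnE)
      fix x assume x: "x \<in> W - (\<lambda>x. x + v) ` W"
      show "x \<in> Q"
      proof (rule ccontr)
        assume "x \<notin> Q"
        then have "x - v \<in> W" using V2(3)[of v x] v x closure_subset interior_subset by blast
        moreover have "x = (x - v) + v" by simp
        ultimately show False using x by blast
      qed
    next
      fix x assume x: "x \<in> (\<lambda>x. x + v) ` W - W"
      then show "x \<in> Q" using V1(3)[of v] v closure_subset interior_subset by blast
    qed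
  qed (use V1 V2 in auto)
qed

section \<open>Almost periods of a regular model set\<close>

theorem theorem8p3:
  fixes mG :: "'g::{topological_group_add,t2_space} measure"
    and mH :: "'h::{topological_group_add,t2_space} measure"
    and L :: "('g \<times> 'h) set"
    and W :: "'h set"
  assumes "cut_and_project_scheme mG mH L"
    and "amenable mG"
    and "regular_window mH W"
  shows "right_uniformly_mean_almost_periodic mG (model_set L W)"
  unfolding right_uniformly_mean_almost_periodic_def
proof (intro allI impI)
  fix \<epsilon> :: real assume "\<epsilon> > 0"
  note c = assms(1)[unfolded cut_and_project_scheme_def]
  have L: "uniform_lattice L" and dense: "closure (snd ` L) = UNIV"
    and mH: "left_haar_measure mH" using c by auto
  have W: "compact (closure W)" "emeasure mH (closure W \<inter> closure (UNIV - W)) = 0"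
    using assms(3) unfolding regular_window_def by auto
  obtain V0 N where V0: "open V0" "compact N" "(0::'h) \<in> V0" "V0 \<subseteq> N"
    using zero_nbhd_compact c by blast
  \<comment> \<open>This contains every window \<open>C\<close> that arises from
    \<open>snd l \<in> V0\<close>. It is fixed first because \<open>k\<close> depends on it, and
    \<open>V\<close> will depend on \<open>k\<close> through \<open>\<delta>\<close>.\<close>
  define E where "E = setprod (closure W) N"
  have "compact E" unfolding E_def by (intro compact_setprod W V0)
  then obtain k where k: "k < top" and bound:
    "\<And>C V U. C \<subseteq> E \<Longrightarrow> open V \<Longrightarrow> 0 \<in> V \<Longrightarrow> open U \<Longrightarrow>
       (\<And>v x. v \<in> V \<Longrightarrow> x \<in> C \<Longrightarrow> v + x \<in> U) \<Longrightarrow>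
       upper_leptin_density mG (model_set L C) \<le> k * emeasure mH U"
    using upper_leptin_density_model_set_le[OF assms(1)] by blast
  obtain r where r: "k = ennreal r" "r \<ge> 0" using k by (cases k) auto
  \<comment> \<open>The \<open>+ 1\<close> keeps \<open>\<delta>\<close> positive also when
    \<open>r = 0\<close>.\<close>
  define \<delta> where "\<delta> = ennreal (\<epsilon> / (r + 1))"
  have "\<delta> > 0" unfolding \<delta>_def using \<open>\<epsilon> > 0\<close> r by simp
  have k\<delta>: "k * \<delta> \<le> ennreal \<epsilon>"
    unfolding \<delta>_def r(1) using r(2) \<open>\<epsilon> > 0\<close>
    by (simp add: ennreal_mult'[symmetric] field_simps)
  have "compact (closure W \<inter> closure (UNIV - W))" by (intro compact_Int_closed W) simp
  then obtain Q U V1 where Q: "open Q" "closure W \<inter> closure (UNIV - W) \<subseteq> Q"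
    and U: "open U" "emeasure mH U < \<delta>" and V1: "open V1" "0 \<in> V1"
    and VQ: "\<And>v x. v \<in> V1 \<Longrightarrow> x \<in> Q \<Longrightarrow> v + x \<in> U"
    using compact_null_inner_outer_nbhd[OF mH _ W(2) \<open>\<delta> > 0\<close>] by blast
  obtain V2 where V2: "open V2" "0 \<in> V2"
    "\<And>v. v \<in> V2 \<Longrightarrow> (W - (\<lambda>x. x + v) ` W) \<union> ((\<lambda>x. x + v) ` W - W) \<subseteq> Q"
    using window_sym_diff_translate[OF W(1) Q] by blast
  \<comment> \<open>\<open>V0\<close> keeps the windows \<open>C\<close> inside \<open>E\<close>,
    and \<open>V2\<close> keeps them inside \<open>Q\<close>.\<close>
  define V where "V = V0 \<inter> V2"
  have V: "open V" "V \<noteq> {}" unfolding V_def using V0 V2 by auto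
  show "\<exists>T. left_rel_dense T \<and> right_rel_dense T \<and>
           (\<forall>t\<in>T. upper_leptin_density mG
                     ((model_set L W - (\<lambda>x. x + t) ` model_set L W)
                      \<union> ((\<lambda>x. x + t) ` model_set L W - model_set L W)) \<le> ennreal \<epsilon>)"
  proof (intro exI[of _ "model_set L V"] conjI ballI)
    show "left_rel_dense (model_set L V)" by (rule left_rel_dense_model_set[OF L dense V])
    show "right_rel_dense (model_set L V)" by (rule right_rel_dense_model_set[OF L dense V])
    fix t assume "t \<in> model_set L V"
    then obtain l where l: "l \<in> L" "snd l \<in> V" "t = fst l" unfolding model_set_def by auto
    define C where "C = (W - (\<lambda>x. x + snd l) ` W) \<union> ((\<lambda>x. x + snd l) ` W - W)"
    have "C \<subseteq> E"
    proof
      fix x assume "x \<in> C"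
      then have "x \<in> W \<or> x \<in> (\<lambda>x. x + snd l) ` W" unfolding C_def by blast
      then obtain w v where w: "w \<in> W" "v \<in> N" "x = w + v"
      proof
        assume "x \<in> W"
        then show thesis using that[of x 0] V0 by auto
      next
        assume "x \<in> (\<lambda>x. x + snd l) ` W"
        then show thesis using that[of _ "snd l"] V0 l unfolding V_def by auto
      qed
      then show "x \<in> E" unfolding E_def using closure_subset[of W] by (auto intro: setprodI)
    qed
    moreover have "C \<subseteq> Q" unfolding C_def using V2(3) l unfolding V_def by blast
    ultimately have *: "upper_leptin_density mG (model_set L C) \<le> k * emeasure mH U"
      by (intro bound[OF _ V1 U(1)]) (auto intro: VQ)
    have "upper_leptin_density mG
        ((model_set L W - (\<lambda>x. x + t) ` model_set L W)
         \<union> ((\<lambda>x. x + t) ` model_set L W - model_set L W))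
        \<le> upper_leptin_density mG (model_set L C)"
      unfolding C_def l(3)
      by (intro upper_leptin_density_mono model_set_sym_diff_translate L l)
    also note *
    also have "k * emeasure mH U \<le> k * \<delta>" using U by (intro mult_left_mono) auto
    also note k\<delta>
    finally show "upper_leptin_density mG
        ((model_set L W - (\<lambda>x. x + t) ` model_set L W)
         \<union> ((\<lambda>x. x + t) ` model_set L W - model_set L W)) \<le> ennreal \<epsilon>" .
  qed
qed

end
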